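(* Let $n$ be a positive integer, let $m > 1$ and $0\le k\le m$ be integers, and let $A$ and $B$ be $n\times n$ Hermitian matrices of norm $1$. Then $$\left|\mathrm{Tr}[S_{m,k}(A,B)]\right| \leq \binom{m}{k}.$$ Moreover, if $m > k > 0$, then equality holds only when $A = B$ or $A = -B$, and if in addition $m > 2$, then equality holds only when also $A$ has precisely one nonzero eigenvalue (counted with multiplicity).
   Context: Matrices are complex. For a complex matrix $C$, $C^*$ denotes the conjugate transpose, and the norm is $\|C\| = \mathrm{Tr}[CC^*]^{1/2}$. For $n\times n$ matrices $A,B$ and integers $m\ge 0$, $0\le k\le m$, $S_{m,k}(A,B)$ denotes the sum of all words of length $m$ in $A$ and $B$ in which exactly $k$ $B$'s appear, i.e. the (matrix) coefficient of $t^k$ in $(A+tB)^m$ (so $S_{0,0}(A,B)=I$). *)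

theory Defs
  imports
    "Jordan_Normal_Form.Char_Poly"
    "Jordan_Normal_Form.Schur_Decomposition"
begin

definition mat_trace :: "complex mat \<Rightarrow> complex" where
  "mat_trace A = (\<Sum>i<dim_row A. A $$ (i, i))"

definition hermitian_mat :: "complex mat \<Rightarrow> bool" where
  "hermitian_mat A \<longleftrightarrow> mat_adjoint A = A"

(* Taking the real part loses nothing: see mat_norm_square below. *)
definition mat_norm :: "complex mat \<Rightarrow> real" where
  "mat_norm C = sqrt (Re (mat_trace (C * mat_adjoint C)))"

(* A word in A and B is a list of Booleans, where False stands for A and True for B.
   The dimension n is only needed for the value of the empty word. *)
fun word_prod :: "nat \<Rightarrow> complex mat \<Rightarrow> complex mat \<Rightarrow> bool list \<Rightarrow> complex mat" where
  "word_prod n A B [] = 1\<^sub>m n"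
| "word_prod n A B (b # w) = (if b then B else A) * word_prod n A B w"

definition words :: "nat \<Rightarrow> nat \<Rightarrow> bool list set" where
  "words m k = {w. length w = m \<and> count_list w True = k}"

(* The sum of matrices is written entrywise, as the type of matrices of all sizes is not
   a commutative monoid.  The description as a coefficient of the m-th power of A + tB
   is word_sum_eq_coeff below. *)
definition word_sum :: "nat \<Rightarrow> nat \<Rightarrow> nat \<Rightarrow> complex mat \<Rightarrow> complex mat \<Rightarrow> complex mat" where
  "word_sum n m k A B = mat n n (\<lambda>(i, j). \<Sum>w\<in>words m k. word_prod n A B w $$ (i, j))"

(* Eigenvalues are counted with algebraic multiplicity. *)
definition num_nonzero_eigenvalues :: "complex mat \<Rightarrow> nat" where
  "num_nonzero_eigenvalues A = (\<Sum>x | eigenvalue A x \<and> x \<noteq> 0. order x (char_poly A))"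

lemma mat_norm_square:
  "complex_of_real ((mat_norm C)\<^sup>2) = mat_trace (C * mat_adjoint C)"
proof -
  have e: "(C * mat_adjoint C) $$ (i, i) = (\<Sum>j<dim_col C. of_real ((cmod (C $$ (i, j)))\<^sup>2))"
    if "i < dim_row C" for i
    using that unfolding mat_adjoint_def
    by (auto simp: scalar_prod_def mat_of_rows_def complex_norm_square lessThan_atLeast0 
        simp del: of_real_power intro!: sum.cong)
  have t: "mat_trace (C * mat_adjoint C) =
      of_real (\<Sum>i<dim_row C. \<Sum>j<dim_col C. (cmod (C $$ (i, j)))\<^sup>2)"
    unfolding mat_trace_def by (simp add: e)
  show ?thesis
    unfolding mat_norm_def t Re_complex_of_real
    by (subst real_sqrt_pow2) (auto intro!: sum_nonneg)
qed

lemma finite_words: "finite (words m k)"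
  by (rule finite_subset[OF _ finite_lists_length_eq[of "UNIV :: bool set" m]])
    (auto simp: words_def)

lemma word_prod_carrier:
  assumes "A \<in> carrier_mat n n" "B \<in> carrier_mat n n"
  shows "word_prod n A B w \<in> carrier_mat n n"
  using assms by (induction w) auto

lemma words_Suc:
  "words (Suc m) k = (#) False ` words m k \<union>
     (if k = 0 then {} else (#) True ` words m (k - 1))"
proof (rule Set.set_eqI)
  fix w show "w \<in> words (Suc m) k \<longleftrightarrow> w \<in> (#) False ` words m k \<union>
     (if k = 0 then {} else (#) True ` words m (k - 1))"
    by (cases w; cases "hd w") (auto simp: words_def image_iff)
qed

lemma word_sum_eq_coeff:
  assumes A: "A \<in> carrier_mat n n" and B: "B \<in> carrier_mat n n"
  shows "word_sum n m k A B =
    map_mat (\<lambda>p. coeff p k) ((map_mat (\<lambda>a. [:a:]) A + map_mat (\<lambda>b. [:0, b:]) B) ^\<^sub>m m)"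
proof -
  define P where "P = map_mat (\<lambda>a. [:a:]) A + map_mat (\<lambda>b. [:0, b:]) B"
  have P: "P \<in> carrier_mat n n" using A B by (auto simp: P_def)
  have Q: "P ^\<^sub>m m \<in> carrier_mat n n" for m using P by simp
  have PS: "P ^\<^sub>m Suc m = P * P ^\<^sub>m m" for m
  proof (induction m)
    case 0 show ?case using P by simp
  next
    case (Suc m)
    have "P ^\<^sub>m Suc (Suc m) = (P * P ^\<^sub>m m) * P" using Suc by simp
    also have "\<dots> = P * (P ^\<^sub>m m * P)" by (rule assoc_mult_mat[OF P Q P])
    finally show ?case by simp
  qed
  have key: "(\<Sum>w\<in>words m k. word_prod n A B w $$ (i, j)) = coeff ((P ^\<^sub>m m) $$ (i, j)) k"
    if "i < n" "j < n" for i j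
    using that
  proof (induction m arbitrary: i k)
    case 0
    have "words 0 k = (if k = 0 then {[]} else {})" by (auto simp: words_def)
    then show ?case using 0 P by (simp add: coeff_eq_0 split: nat.split)
  next
    case (Suc m)
    let ?W = "\<lambda>l k. (\<Sum>w\<in>words m k. word_prod n A B w $$ (l, j))"
    have ent: "(M * word_prod n A B w) $$ (i, j) = (\<Sum>l<n. M $$ (i, l) * word_prod n A B w $$ (l, j))"
      if "M \<in> carrier_mat n n" for M w
      using that word_prod_carrier[OF A B, of w] Suc.prems
      by (auto simp: scalar_prod_def lessThan_atLeast0 intro!: sum.cong)
    have mult: "(\<Sum>w\<in>words m k. (M * word_prod n A B w) $$ (i, j)) = (\<Sum>l<n. M $$ (i, l) * ?W l k)"
      if "M \<in> carrier_mat n n" for M k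
      unfolding ent[OF that] sum_distrib_left by (rule sum.swap)
    have "(\<Sum>w\<in>words (Suc m) k. word_prod n A B w $$ (i, j)) =
        (\<Sum>w\<in>(#) False ` words m k. word_prod n A B w $$ (i, j)) +
        (if k = 0 then 0 else \<Sum>w\<in>(#) True ` words m (k - 1). word_prod n A B w $$ (i, j))"
      unfolding words_Suc by (cases "k = 0") (auto intro!: sum.union_disjoint simp: finite_words)
    also have "\<dots> = (\<Sum>l<n. A $$ (i, l) * ?W l k) +
        (if k = 0 then 0 else \<Sum>l<n. B $$ (i, l) * ?W l (k - 1))"
      by (simp add: sum.reindex mult[OF A] mult[OF B])
    also have "\<dots> = (\<Sum>l<n. coeff (P $$ (i, l) * (P ^\<^sub>m m) $$ (l, j)) k)"
    proof -
      have "coeff (P $$ (i, l) * (P ^\<^sub>m m) $$ (l, j)) k =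
          A $$ (i, l) * ?W l k + (if k = 0 then 0 else B $$ (i, l) * ?W l (k - 1))"
        if l: "l < n" for l
      proof -
        have "P $$ (i, l) = [:A $$ (i, l), B $$ (i, l):]"
          using A B l Suc.prems by (simp add: P_def)
        then show ?thesis using Suc.IH[OF l Suc.prems(2)]
          by (cases k) auto
      qed
      then show ?thesis by (simp add: sum.distrib)
    qed
    also have "\<dots> = coeff ((P * P ^\<^sub>m m) $$ (i, j)) k"
      using P Q[of m] Suc.prems by (simp add: scalar_prod_def coeff_sum lessThan_atLeast0)
    finally show ?case unfolding PS .
  qed
  show ?thesis
    unfolding P_def[symmetric] word_sum_def
  proof (rule eq_matI, goal_cases)
    case (1 i j)
    then have "i < n" "j < n" using Q[of m] by (simp_all only: index_map_mat carrier_matD)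
    then show ?case using Q[of m] by (simp only: index_mat index_map_mat carrier_matD split key)
  qed (use Q[of m] in \<open>simp_all only: dim_row_mat dim_col_mat index_map_mat carrier_matD\<close>)
qed

end

theory Submission
  imports Defs
begin

text \<open>
  By the triangle inequality it suffices to bound the trace of each of the \<open>m choose k\<close> words
  by 1.  The norm is the Frobenius norm, so Cauchy--Schwarz does this twice: applied to rows and
  columns it gives submultiplicativity (\<open>mat_norm_mult_le\<close>), so that nonempty words have norm at
  most 1, and applied to all entries at once it gives \<open>|Tr XY| \<le> \<parallel>X\<parallel> \<parallel>Y\<parallel>\<close>
  (\<open>cmod_trace_mult_le\<close>).  The empty word has norm \<open>\<surd>n\<close>, which is why \<open>m > 1\<close> is
  required: a word is split into two nonempty pieces.

  If equality holds, every word has a trace of modulus exactly 1.  For \<open>0 < k < m\<close> one of the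
  words is \<open>ABU\<close>.  When \<open>m = 2\<close> this says \<open>|Tr AB| = 1\<close>, the equality case of Cauchy--Schwarz,
  so \<open>A\<close> is a multiple of \<open>B\<close>, and the factor is a real number of modulus 1 because both
  matrices are Hermitian of norm 1.

  When \<open>m > 2\<close>, \<open>U\<close> is nonempty and \<open>1 = |Tr ABU| \<le> \<parallel>AB\<parallel> \<parallel>U\<parallel> \<le> \<parallel>AB\<parallel> \<le> 1\<close>, so submultiplicativity
  is an equality for \<open>A\<close> and \<open>B\<close>.  Then Cauchy--Schwarz is an equality for every row of \<open>A\<close>
  and every column of \<open>B\<close>: they are all conjugate parallel, so that \<open>A\<close> has rank one and \<open>B\<close> is
  a multiple of it (\<open>norm_mult_eq_rank_one\<close>).  Rank one yields \<open>A\<^sup>2 = (Tr A) A\<close>, so the eigenvalues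
  are 0 and \<open>Tr A\<close>; their sum being \<open>Tr A \<noteq> 0\<close>, exactly one is nonzero.
\<close>

section \<open>The Cauchy--Schwarz inequality and its equality case\<close>

text \<open>
  The squared distance that decides both the inequality and its equality case: up to the scaling by
  \<open>Q\<close>, which avoids a division, the summand is the residual of \<open>f\<close> after orthogonal projection
  onto the conjugate of \<open>g\<close>.  The product is bilinear, without a conjugate, because that is the form
  taken by entries and traces of matrix products.
\<close>

lemma norm_residual_sum:
  fixes f g :: "'a \<Rightarrow> complex" and I :: "'a set"
  defines "Q \<equiv> \<Sum>i\<in>I. (cmod (g i))\<^sup>2" and "z \<equiv> \<Sum>i\<in>I. f i * g i"
  shows "(\<Sum>i\<in>I. (cmod (of_real Q * f i - z * cnj (g i)))\<^sup>2)
    = Q * ((\<Sum>i\<in>I. (cmod (f i))\<^sup>2) * Q - (cmod z)\<^sup>2)"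
proof -
  have "of_real (\<Sum>i\<in>I. (cmod (of_real Q * f i - z * cnj (g i)))\<^sup>2)
      = (\<Sum>i\<in>I. of_real Q * of_real Q * (f i * cnj (f i)) - of_real Q * cnj z * (f i * g i)
           - of_real Q * z * cnj (f i * g i) + z * cnj z * (g i * cnj (g i)))"
    unfolding of_real_sum
    by (rule sum.cong[OF refl]) (simp add: complex_norm_square algebra_simps del: of_real_power)
  also have "\<dots> = of_real Q * of_real Q * of_real (\<Sum>i\<in>I. (cmod (f i))\<^sup>2) - of_real Q * cnj z * z
           - of_real Q * z * cnj z + z * cnj z * of_real Q"
    unfolding Q_def z_def
    by (simp add: sum.distrib sum_subtractf sum_distrib_left[symmetric] complex_norm_square
        del: of_real_power)
  also have "\<dots> = of_real (Q * ((\<Sum>i\<in>I. (cmod (f i))\<^sup>2) * Q - (cmod z)\<^sup>2))"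
    by (simp add: complex_norm_square algebra_simps del: of_real_power)
  finally show ?thesis unfolding of_real_eq_iff .
qed

lemma cauchy_schwarz_bilinear:
  fixes f g :: "'a \<Rightarrow> complex"
  assumes "finite I"
  shows "(cmod (\<Sum>i\<in>I. f i * g i))\<^sup>2 \<le> (\<Sum>i\<in>I. (cmod (f i))\<^sup>2) * (\<Sum>i\<in>I. (cmod (g i))\<^sup>2)"
proof (cases "(\<Sum>i\<in>I. (cmod (g i))\<^sup>2) = 0")
  case True
  then have "\<forall>i\<in>I. g i = 0" using assms by (simp add: sum_nonneg_eq_0_iff)
  then show ?thesis by simp
next
  case False
  moreover have "(\<Sum>i\<in>I. (cmod (g i))\<^sup>2) \<ge> 0" by (simp add: sum_nonneg)
  ultimately have pos: "(\<Sum>i\<in>I. (cmod (g i))\<^sup>2) > 0" by simp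
  have "0 \<le> (\<Sum>i\<in>I. (cmod (g i))\<^sup>2) * ((\<Sum>i\<in>I. (cmod (f i))\<^sup>2) * (\<Sum>i\<in>I. (cmod (g i))\<^sup>2)
      - (cmod (\<Sum>i\<in>I. f i * g i))\<^sup>2)"
    unfolding norm_residual_sum[symmetric] by (simp add: sum_nonneg)
  then show ?thesis using pos by (simp add: zero_le_mult_iff)
qed

lemma cauchy_schwarz_bilinear_eqD:
  fixes f g :: "'a \<Rightarrow> complex"
  assumes "finite I" "i \<in> I"
    and eq: "(cmod (\<Sum>i\<in>I. f i * g i))\<^sup>2 = (\<Sum>i\<in>I. (cmod (f i))\<^sup>2) * (\<Sum>i\<in>I. (cmod (g i))\<^sup>2)"
  shows "of_real (\<Sum>i\<in>I. (cmod (g i))\<^sup>2) * f i = (\<Sum>i\<in>I. f i * g i) * cnj (g i)"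
proof -
  have "(\<Sum>i\<in>I. (cmod (of_real (\<Sum>i\<in>I. (cmod (g i))\<^sup>2) * f i
      - (\<Sum>i\<in>I. f i * g i) * cnj (g i)))\<^sup>2) = 0"
    unfolding norm_residual_sum by (simp add: eq)
  then show ?thesis using assms(1,2) by (simp add: sum_nonneg_eq_0_iff)
qed

section \<open>The Frobenius norm\<close>

lemma mat_adjoint_index:
  assumes "C \<in> carrier_mat n m" "i < m" "j < n"
  shows "mat_adjoint C $$ (i, j) = cnj (C $$ (j, i))"
  using assms unfolding mat_adjoint_def by (auto simp: mat_of_rows_def)

lemma hermitian_mat_index:
  assumes "hermitian_mat A" "A \<in> carrier_mat n n" "i < n" "j < n"
  shows "cnj (A $$ (i, j)) = A $$ (j, i)"
  using mat_adjoint_index[OF assms(2,4,3)] assms(1) by (simp add: hermitian_mat_def)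

lemma mult_index_sum:
  assumes "A \<in> carrier_mat n m" "B \<in> carrier_mat m p" "i < n" "j < p"
  shows "(A * B) $$ (i, j) = (\<Sum>l<m. A $$ (i, l) * B $$ (l, j))"
  using assms by (auto simp: scalar_prod_def lessThan_atLeast0 intro!: sum.cong)

lemma mat_norm_nonneg: "mat_norm C \<ge> 0"
proof -
  have "0 \<le> Re (mat_trace (C * mat_adjoint C))"
    by (metis Re_complex_of_real mat_norm_square zero_le_power2)
  then show ?thesis unfolding mat_norm_def by simp
qed

lemma mat_norm_square_sum:
  assumes "C \<in> carrier_mat n m"
  shows "(mat_norm C)\<^sup>2 = (\<Sum>i<n. \<Sum>j<m. (cmod (C $$ (i, j)))\<^sup>2)"
proof -
  have adj: "mat_adjoint C \<in> carrier_mat m n"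
    using assms unfolding mat_adjoint_def by auto
  have "complex_of_real ((mat_norm C)\<^sup>2) = of_real (\<Sum>i<n. \<Sum>j<m. (cmod (C $$ (i, j)))\<^sup>2)"
    unfolding mat_norm_square mat_trace_def using assms adj
    by (simp add: mult_index_sum[OF assms adj] mat_adjoint_index[OF assms] complex_norm_square
        del: of_real_power index_mult_mat(1))
  then show ?thesis unfolding of_real_eq_iff .
qed

lemma mat_trace_mult:
  assumes "X \<in> carrier_mat n m" "Y \<in> carrier_mat m n"
  shows "mat_trace (X * Y) = (\<Sum>(i, l)\<in>{..<n} \<times> {..<m}. X $$ (i, l) * Y $$ (l, i))"
  using assms unfolding mat_trace_def
  by (simp add: mult_index_sum[OF assms] sum.cartesian_product del: index_mult_mat(1))

lemma mat_trace_mult_comm: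
  assumes "X \<in> carrier_mat n m" "Y \<in> carrier_mat m n"
  shows "mat_trace (X * Y) = mat_trace (Y * X)"
  unfolding mat_trace_mult[OF assms] mat_trace_mult[OF assms(2,1)]
  by (simp add: sum.cartesian_product[symmetric] mult.commute) (rule sum.swap)

text \<open>
  These sums arise when a trace of a product is read as one sum over index pairs; the second
  matrix then appears transposed, which does not change its norm.
\<close>

lemma mat_norm_squares_pairs:
  assumes "X \<in> carrier_mat n m" "Y \<in> carrier_mat m n"
  shows "(\<Sum>p\<in>{..<n} \<times> {..<m}. (cmod (X $$ p))\<^sup>2) = (mat_norm X)\<^sup>2"
    and "(\<Sum>p\<in>{..<n} \<times> {..<m}. (cmod (Y $$ (snd p, fst p)))\<^sup>2) = (mat_norm Y)\<^sup>2"
  unfolding mat_norm_square_sum[OF assms(1)] mat_norm_square_sum[OF assms(2)]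
   apply (simp add: sum.cartesian_product)
  apply (subst sum.swap)
  apply (simp add: sum.cartesian_product case_prod_unfold)
  done

lemma cmod_trace_mult_le:
  assumes "X \<in> carrier_mat n m" "Y \<in> carrier_mat m n"
  shows "cmod (mat_trace (X * Y)) \<le> mat_norm X * mat_norm Y"
proof -
  have "(cmod (mat_trace (X * Y)))\<^sup>2 \<le> (mat_norm X * mat_norm Y)\<^sup>2"
    using cauchy_schwarz_bilinear[of "{..<n} \<times> {..<m}" "\<lambda>p. X $$ p" "\<lambda>p. Y $$ (snd p, fst p)"]
    unfolding mat_norm_squares_pairs[OF assms] mat_trace_mult[OF assms]
    by (simp add: power_mult_distrib case_prod_unfold)
  then show ?thesis
    by (rule power2_le_imp_le) (simp add: mat_norm_nonneg)
qed

lemma cmod_trace_mult_eqD: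
  assumes "X \<in> carrier_mat n m" "Y \<in> carrier_mat m n" "i < n" "l < m"
    and "cmod (mat_trace (X * Y)) = mat_norm X * mat_norm Y"
  shows "of_real ((mat_norm Y)\<^sup>2) * X $$ (i, l) = mat_trace (X * Y) * cnj (Y $$ (l, i))"
  using cauchy_schwarz_bilinear_eqD[of "{..<n} \<times> {..<m}" "(i, l)" "\<lambda>p. X $$ p"
      "\<lambda>p. Y $$ (snd p, fst p)"] assms(3-5)
  unfolding mat_norm_squares_pairs[OF assms(1,2)] mat_trace_mult[OF assms(1,2)]
  by (simp add: power_mult_distrib case_prod_unfold)

lemma mat_norm_mult_entry_le:
  assumes "X \<in> carrier_mat n m" "Y \<in> carrier_mat m p" "i < n" "j < p"
  shows "(cmod ((X * Y) $$ (i, j)))\<^sup>2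
    \<le> (\<Sum>l<m. (cmod (X $$ (i, l)))\<^sup>2) * (\<Sum>l<m. (cmod (Y $$ (l, j)))\<^sup>2)"
  unfolding mult_index_sum[OF assms] by (rule cauchy_schwarz_bilinear) simp

lemma mat_norm_squares_product:
  assumes "X \<in> carrier_mat n m" "Y \<in> carrier_mat m p"
  shows "(mat_norm X * mat_norm Y)\<^sup>2 = (\<Sum>i<n. \<Sum>j<p.
    (\<Sum>l<m. (cmod (X $$ (i, l)))\<^sup>2) * (\<Sum>l<m. (cmod (Y $$ (l, j)))\<^sup>2))"
proof -
  have "(mat_norm Y)\<^sup>2 = (\<Sum>j<p. \<Sum>l<m. (cmod (Y $$ (l, j)))\<^sup>2)"
    unfolding mat_norm_square_sum[OF assms(2)] by (rule sum.swap)
  then show ?thesis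
    unfolding power_mult_distrib mat_norm_square_sum[OF assms(1)] by (simp only: sum_product)
qed

lemma mat_norm_mult_le:
  assumes "X \<in> carrier_mat n m" "Y \<in> carrier_mat m p"
  shows "mat_norm (X * Y) \<le> mat_norm X * mat_norm Y"
proof (rule power2_le_imp_le)
  have XY: "X * Y \<in> carrier_mat n p" using assms by simp
  show "(mat_norm (X * Y))\<^sup>2 \<le> (mat_norm X * mat_norm Y)\<^sup>2"
    unfolding mat_norm_square_sum[OF XY] mat_norm_squares_product[OF assms]
    by (intro sum_mono mat_norm_mult_entry_le[OF assms]) auto
qed (simp add: mat_norm_nonneg)

text \<open>
  The squared norms of \<open>XY\<close> and the product of norms are sums over \<open>i, j\<close> of the two sides of
  Cauchy--Schwarz for row \<open>i\<close> and column \<open>j\<close>, so equal totals force every summand to be equal.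
\<close>

lemma mat_norm_mult_eqD:
  assumes X: "X \<in> carrier_mat n m" and Y: "Y \<in> carrier_mat m p"
    and ij: "i < n" "j < p"
    and eq: "mat_norm (X * Y) = mat_norm X * mat_norm Y"
  shows "(cmod ((X * Y) $$ (i, j)))\<^sup>2
    = (\<Sum>l<m. (cmod (X $$ (i, l)))\<^sup>2) * (\<Sum>l<m. (cmod (Y $$ (l, j)))\<^sup>2)"
proof -
  have XY: "X * Y \<in> carrier_mat n p" using X Y by simp
  let ?u = "\<lambda>i j. (\<Sum>l<m. (cmod (X $$ (i, l)))\<^sup>2) * (\<Sum>l<m. (cmod (Y $$ (l, j)))\<^sup>2)"
  have "(\<Sum>i<n. \<Sum>j<p. ?u i j - (cmod ((X * Y) $$ (i, j)))\<^sup>2) = 0"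
    using arg_cong[OF eq, of "\<lambda>x. x\<^sup>2"]
    unfolding mat_norm_square_sum[OF XY] mat_norm_squares_product[OF X Y]
    by (simp add: sum_subtractf)
  moreover have nn: "0 \<le> ?u i j - (cmod ((X * Y) $$ (i, j)))\<^sup>2" if "i < n" "j < p" for i j
    using mat_norm_mult_entry_le[OF X Y that] by simp
  ultimately have "\<forall>i<n. (\<Sum>j<p. ?u i j - (cmod ((X * Y) $$ (i, j)))\<^sup>2) = 0"
    by (subst (asm) sum_nonneg_eq_0_iff) (auto intro!: sum_nonneg simp del: index_mult_mat(1))
  with ij have "(\<Sum>j<p. ?u i j - (cmod ((X * Y) $$ (i, j)))\<^sup>2) = 0" by blast
  then have "?u i j - (cmod ((X * Y) $$ (i, j)))\<^sup>2 = 0"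
    by (subst (asm) sum_nonneg_eq_0_iff) (use nn ij in \<open>auto simp del: index_mult_mat(1)\<close>)
  then show ?thesis by simp
qed

section \<open>Equality cases for Hermitian matrices\<close>

text \<open>
  The norms force \<open>|c| = 1\<close>, and comparing a nonzero entry with its mirror image forces \<open>c\<close> to be
  real.
\<close>

lemma hermitian_scalar_multiple:
  assumes A: "A \<in> carrier_mat n n" "hermitian_mat A" "mat_norm A = 1"
    and B: "B \<in> carrier_mat n n" "hermitian_mat B" "mat_norm B = 1"
    and c: "\<And>i j. i < n \<Longrightarrow> j < n \<Longrightarrow> A $$ (i, j) = c * B $$ (i, j)"
  shows "A = B \<or> A = - B"
proof -
  have "(mat_norm A)\<^sup>2 = (cmod c)\<^sup>2 * (mat_norm B)\<^sup>2"
    unfolding mat_norm_square_sum[OF A(1)] mat_norm_square_sum[OF B(1)]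
    by (simp add: c norm_mult power_mult_distrib sum_distrib_left)
  then have c1: "(cmod c)\<^sup>2 = 1" using A(3) B(3) by simp
  have "\<exists>i<n. \<exists>j<n. B $$ (i, j) \<noteq> 0"
  proof (rule ccontr)
    assume "\<not> (\<exists>i<n. \<exists>j<n. B $$ (i, j) \<noteq> 0)"
    then have "(mat_norm B)\<^sup>2 = 0" unfolding mat_norm_square_sum[OF B(1)] by simp
    then show False using B(3) by simp
  qed
  then obtain i j where ij: "i < n" "j < n" "B $$ (i, j) \<noteq> 0" by blast
  have "c * B $$ (i, j) = cnj (A $$ (j, i))"
    using ij hermitian_mat_index[OF A(2,1)] by (simp add: c)
  also have "\<dots> = cnj c * B $$ (i, j)"
    using ij hermitian_mat_index[OF B(2,1)] by (simp add: c)
  finally have "cnj c = c" using ij by simp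
  then have "c * c = 1" using c1 complex_norm_square[of c] by simp
  then have "c = 1 \<or> c = -1" by (simp add: square_eq_1_iff)
  then show ?thesis
  proof
    assume "c = 1"
    then have "A = B" using A(1) B(1) c by (intro eq_matI) auto
    then show ?thesis ..
  next
    assume "c = -1"
    then have "A = - B" using A(1) B(1) c by (intro eq_matI) auto
    then show ?thesis ..
  qed
qed

lemma trace_mult_eq_scalar:
  assumes A: "A \<in> carrier_mat n n" "hermitian_mat A" "mat_norm A = 1"
    and B: "B \<in> carrier_mat n n" "hermitian_mat B" "mat_norm B = 1"
    and AB1: "cmod (mat_trace (A * B)) = 1"
  shows "A = B \<or> A = - B"
proof (rule hermitian_scalar_multiple[OF A B])
  fix i j assume "i < n" "j < n"
  then show "A $$ (i, j) = mat_trace (A * B) * B $$ (i, j)"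
    using cmod_trace_mult_eqD[OF A(1) B(1), of i j] AB1 A(3) B(3) hermitian_mat_index[OF B(2,1)]
    by simp
qed

section \<open>Counting eigenvalues through the trace\<close>

lemma order_prod_linear:
  fixes as :: "'a :: field list"
  shows "order x (\<Prod>a\<leftarrow>as. [:- a, 1:]) = count_list as x"
proof (induction as)
  case Nil
  then show ?case by (simp add: order_0I)
next
  case (Cons a as)
  have "(\<Prod>a\<leftarrow>a # as. [:- a, 1:]) \<noteq> 0" unfolding prod_list_zero_iff by auto
  moreover have "order x [:- a, 1:] = (if x = a then 1 else 0)"
    using order_linear_power[of x "- a" 1] by (auto simp: order_0I)
  ultimately show ?case using Cons by (subst list.map, subst prod_list.Cons, subst order_mult) auto
qed

lemma mat_trace_eq_sum_list_eigenvalues: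
  assumes A: "A \<in> carrier_mat n n" and cp: "char_poly A = (\<Prod>e\<leftarrow>es. [:- e, 1:])"
  shows "mat_trace A = sum_list es"
proof -
  obtain T P Q where "schur_decomposition A es = (T, P, Q)" by (cases "schur_decomposition A es") auto
  from schur_decomposition[OF A cp this]
  have sim: "similar_mat_wit A T P Q" and diag: "diag_mat T = es" by auto
  note w = similar_mat_witD2[OF A sim]
  have "mat_trace A = mat_trace (P * (T * Q))"
    using w by (simp add: assoc_mult_mat[of P n n T n Q n])
  also have "\<dots> = mat_trace (T * Q * P)"
    using w by (intro mat_trace_mult_comm[of _ n n]) auto
  also have "T * Q * P = T"
    using w by (simp add: assoc_mult_mat[of T n n Q n P n])
  also have "mat_trace T = sum_list es"
    unfolding mat_trace_def diag[symmetric] diag_mat_def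
    by (simp add: interv_sum_list_conv_sum_set_nat lessThan_atLeast0)
  finally show ?thesis .
qed

text \<open>
  Every eigenvalue satisfies \<open>x\<^sup>2 = tx\<close>, hence is 0 or \<open>t\<close>.  The sum of all eigenvalues is then \<open>t\<close>
  times the multiplicity of \<open>t\<close>; as it also equals the trace \<open>t\<close>, that multiplicity is 1.
\<close>

lemma num_nonzero_eigenvalues_eq_1:
  assumes A: "A \<in> carrier_mat n n" and AA: "A * A = t \<cdot>\<^sub>m A" and t: "mat_trace A = t" "t \<noteq> 0"
  shows "num_nonzero_eigenvalues A = 1"
proof -
  obtain es where cp: "char_poly A = (\<Prod>e\<leftarrow>es. [:- e, 1:])"
    using char_poly_factorized[OF A] by blast
  have ev: "x = 0 \<or> x = t" if "eigenvalue A x" for x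
  proof -
    obtain v where v: "v \<in> carrier_vec n" "v \<noteq> 0\<^sub>v n" "A *\<^sub>v v = x \<cdot>\<^sub>v v"
      using \<open>eigenvalue A x\<close> A unfolding eigenvalue_def eigenvector_def by auto
    have smult: "(t \<cdot>\<^sub>m A) *\<^sub>v v = t \<cdot>\<^sub>v (A *\<^sub>v v)"
      using v(1) A by (intro eq_vecI) auto
    have "(x * x) \<cdot>\<^sub>v v = (A * A) *\<^sub>v v"
      using v A by (simp add: assoc_mult_mat_vec[OF A A] mult_mat_vec[OF A] smult_smult_assoc)
    also have "\<dots> = (t * x) \<cdot>\<^sub>v v"
      unfolding AA smult v(3) by (simp add: smult_smult_assoc)
    finally have eq: "(x * x) \<cdot>\<^sub>v v = (t * x) \<cdot>\<^sub>v v" .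
    obtain i where "i < n" "v $ i \<noteq> 0" using v(1,2) by (metis carrier_vecD eq_vecI index_zero_vec)
    moreover have "(x * x) * v $ i = (t * x) * v $ i"
      using arg_cong[OF eq, of "\<lambda>u. u $ i"] \<open>i < n\<close> v(1) by simp
    ultimately show ?thesis by auto
  qed
  have evs: "eigenvalue A x \<longleftrightarrow> x \<in> set es" for x
    unfolding eigenvalue_root_char_poly[OF A] cp
    by (auto simp: poly_prod_list prod_list_zero_iff)
  have "sum_list es = t * of_nat (count_list es t)" if "set es \<subseteq> {0, t}" for es
    using that t(2) by (induction es) (auto simp: algebra_simps)
  moreover have "set es \<subseteq> {0, t}" using ev evs by auto
  ultimately have "t = t * of_nat (count_list es t)"
    using mat_trace_eq_sum_list_eigenvalues[OF A cp] t(1) by metis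
  then have count: "count_list es t = 1" using t(2) by (simp add: of_nat_eq_1_iff)
  then have "t \<in> set es" by (metis count_list_0_iff zero_neq_one)
  then have "{x. eigenvalue A x \<and> x \<noteq> 0} = {t}" using ev evs t(2) by auto
  then show ?thesis
    unfolding num_nonzero_eigenvalues_def by (simp add: cp order_prod_linear count)
qed

section \<open>Equality in submultiplicativity\<close>

text \<open>
  Row \<open>i\<close> of \<open>A\<close> and column \<open>j\<close> of \<open>B\<close> are conjugate parallel for all \<open>i, j\<close>.  Keeping one nonzero
  column of \<open>B\<close> fixed shows that the \<open>2 \<times> 2\<close> minors of \<open>A\<close> vanish, and therefore
  \<open>AXA = Tr(AX) A\<close> for every \<open>X\<close>.  With \<open>X = I\<close> this gives \<open>A\<^sup>2 = tA\<close> for \<open>t = Tr A\<close>, where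
  \<open>t\<^sup>2 = Tr A\<^sup>2 = \<parallel>A\<parallel>\<^sup>2 = 1\<close>.  Summing the parallelism relations over the rows of \<open>A\<close> gives \<open>B = A\<^sup>2B = tAB\<close>,
  by taking adjoints also \<open>B = tBA\<close>, and together \<open>B = ABA = Tr(AB) A\<close>.
\<close>

lemma norm_mult_eq_rank_one:
  assumes A: "A \<in> carrier_mat n n" "hermitian_mat A" "mat_norm A = 1"
    and B: "B \<in> carrier_mat n n" "hermitian_mat B" "mat_norm B = 1"
    and AB1: "mat_norm (A * B) = 1"
  shows "(A = B \<or> A = - B) \<and> num_nonzero_eigenvalues A = 1"
proof -
  \<comment> \<open>The squared norms of the rows of \<open>A\<close> and of the columns of \<open>B\<close>, as complex numbers since they
    are used as scalars below.\<close>
  define R where "R i = complex_of_real (\<Sum>l<n. (cmod (A $$ (i, l)))\<^sup>2)" for i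
  define S where "S j = complex_of_real (\<Sum>l<n. (cmod (B $$ (l, j)))\<^sup>2)" for j
  note hA = hermitian_mat_index[OF A(2,1)] and hB = hermitian_mat_index[OF B(2,1)]
  note AA_sum = mult_index_sum[OF A(1) A(1)] and AB_sum = mult_index_sum[OF A(1) B(1)]
    and BA_sum = mult_index_sum[OF B(1) A(1)]
  have AB: "A * B \<in> carrier_mat n n" using A B by simp
  have eq: "(cmod (\<Sum>l<n. A $$ (i, l) * B $$ (l, j)))\<^sup>2
      = (\<Sum>l<n. (cmod (A $$ (i, l)))\<^sup>2) * (\<Sum>l<n. (cmod (B $$ (l, j)))\<^sup>2)"
    if "i < n" "j < n" for i j
    using mat_norm_mult_eqD[OF A(1) B(1) that] AB1 A(3) B(3) AB_sum[OF that] by simp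
  \<comment> \<open>The equality case of Cauchy--Schwarz, solved for the row of \<open>A\<close> and for the column of \<open>B\<close>; the
    conjugates are absorbed by transposing the Hermitian matrices.\<close>
  have eqS: "S j * A $$ (i, l) = (A * B) $$ (i, j) * B $$ (j, l)"
    if "i < n" "j < n" "l < n" for i j l
    using cauchy_schwarz_bilinear_eqD[OF _ _ eq[OF that(1,2)], of l] that
    by (simp add: S_def hB AB_sum del: index_mult_mat(1))
  have eqR: "R i * B $$ (l, j) = (A * B) $$ (i, j) * A $$ (l, i)"
    if "i < n" "j < n" "l < n" for i j l
    using cauchy_schwarz_bilinear_eqD[of "{..<n}" l "\<lambda>l. B $$ (l, j)" "\<lambda>l. A $$ (i, l)"] that
      eq[OF that(1,2)]
    by (simp add: R_def hA AB_sum mult.commute del: index_mult_mat(1))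
  have sumS: "(\<Sum>j<n. S j) = 1"
    using mat_norm_square_sum[OF B(1)] B(3)
    unfolding S_def of_real_sum[symmetric] by (subst sum.swap) simp
  have sumR: "(\<Sum>i<n. R i) = 1"
    using mat_norm_square_sum[OF A(1)] A(3)
    unfolding R_def of_real_sum[symmetric] by simp
  obtain j where j: "j < n" "S j \<noteq> 0"
    using sumS by (metis lessThan_iff sum.neutral zero_neq_one)
  have minor: "A $$ (i, l) * A $$ (p, q) = A $$ (i, q) * A $$ (p, l)"
    if "i < n" "l < n" "p < n" "q < n" for i l p q
  proof -
    \<comment> \<open>By \<open>eqS\<close> both sides are the same four entries of \<open>AB\<close> and \<open>B\<close> in a different order.\<close>
    have "(S j * A $$ (i, l)) * (S j * A $$ (p, q)) = (S j * A $$ (i, q)) * (S j * A $$ (p, l))"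
      using that j(1) by (simp add: eqS del: index_mult_mat(1))
    then show ?thesis using j(2) by (simp add: mult_ac)
  qed
  define t where "t = mat_trace A"
  have t_sum: "t = (\<Sum>p<n. A $$ (p, p))" using A(1) by (simp add: t_def mat_trace_def)
  have AA: "A * A = t \<cdot>\<^sub>m A"
  proof (rule eq_matI)
    fix i q assume "i < dim_row (t \<cdot>\<^sub>m A)" "q < dim_col (t \<cdot>\<^sub>m A)"
    then have iq: "i < n" "q < n" using A(1) by auto
    then have "(A * A) $$ (i, q) = (\<Sum>p<n. A $$ (i, q) * A $$ (p, p))"
      unfolding AA_sum[OF iq] by (intro sum.cong refl minor) auto
    then show "(A * A) $$ (i, q) = (t \<cdot>\<^sub>m A) $$ (i, q)"
      using iq A(1) by (simp add: t_sum sum_distrib_left mult.commute del: index_mult_mat(1))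
  qed (use A(1) in auto)
  have "t * t = mat_trace (A * A)"
    using A(1) unfolding AA by (simp add: mat_trace_def t_sum sum_distrib_left)
  also have "A * A = A * mat_adjoint A" using A(2) by (simp add: hermitian_mat_def)
  also have "mat_trace (A * mat_adjoint A) = 1"
    using mat_norm_square[of A] A(3) by simp
  finally have tt: "t * t = 1" .
  then have "t = 1 \<or> t = -1" by (simp add: square_eq_1_iff)
  then have t0: "t \<noteq> 0" and tc: "cnj t = t" by auto
  have B_eq_tAB: "B $$ (l, q) = t * (A * B) $$ (l, q)" if "l < n" "q < n" for l q
  proof -
    have "B $$ (l, q) = (\<Sum>i<n. R i * B $$ (l, q))"
      unfolding sum_distrib_right[symmetric] sumR by simp
    also have "\<dots> = (\<Sum>i<n. A $$ (l, i) * (A * B) $$ (i, q))"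
      using that by (intro sum.cong) (auto simp: eqR mult.commute simp del: index_mult_mat(1))
    also have "\<dots> = (A * (A * B)) $$ (l, q)"
      unfolding mult_index_sum[OF A(1) AB that] ..
    also have "A * (A * B) = t \<cdot>\<^sub>m (A * B)"
      using A(1) B(1) by (simp add: assoc_mult_mat[OF A(1) A(1) B(1), symmetric] AA
          mult_smult_assoc_mat[OF A(1) B(1)])
    finally show ?thesis using that A(1) B(1) by simp
  qed
  then have B_eq_tBA: "B $$ (q, l) = t * (\<Sum>p<n. B $$ (q, p) * A $$ (p, l))" if "l < n" "q < n" for l q
  proof -
    have "B $$ (q, l) = cnj (t * (A * B) $$ (l, q))" 
      using that hB[of l q] B_eq_tAB[of l q] by simp
    also have "\<dots> = t * (\<Sum>p<n. B $$ (q, p) * A $$ (p, l))"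
      using that by (simp add: AB_sum tc hA hB mult.commute del: index_mult_mat(1))
    finally show ?thesis .
  qed
  \<comment> \<open>This is \<open>B = ABA\<close>, rewritten by swapping the outer indices of the two factors \<open>A\<close>.\<close>
  have "B $$ (i, q) = mat_trace (A * B) * A $$ (i, q)" if iq: "i < n" "q < n" for i q
  proof -
    have "B $$ (i, q) = t * (\<Sum>l<n. A $$ (i, l) * B $$ (l, q))"
      using B_eq_tAB[OF iq] AB_sum[OF iq] by simp
    also have "\<dots> = t * (\<Sum>l<n. A $$ (i, l) * (t * (\<Sum>p<n. B $$ (l, p) * A $$ (p, q))))"
      by (intro arg_cong[where f = "(*) t"] sum.cong refl) (use iq B_eq_tBA[of q] in simp)
    also have "\<dots> = (t * t) * (\<Sum>l<n. \<Sum>p<n. (A $$ (i, l) * A $$ (p, q)) * B $$ (l, p))"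
      by (simp add: sum_distrib_left mult_ac)
    also have "\<dots> = (\<Sum>l<n. \<Sum>p<n. (A $$ (i, q) * A $$ (p, l)) * B $$ (l, p))"
      unfolding tt mult_1 by (intro sum.cong refl) (use iq minor in auto)
    also have "\<dots> = mat_trace (A * B) * A $$ (i, q)"
      unfolding mat_trace_mult[OF A(1) B(1)] sum.cartesian_product[symmetric]
      by (subst sum.swap) (simp add: sum_distrib_left mult_ac)
    finally show ?thesis .
  qed
  then have "B = A \<or> B = - A"
    by (rule hermitian_scalar_multiple[OF B A])
  then have "A = B \<or> A = - B" by (auto simp: uminus_uminus_mat)
  moreover have "num_nonzero_eigenvalues A = 1"
    using num_nonzero_eigenvalues_eq_1[OF A(1) AA t_def[symmetric] t0] .
  ultimately show ?thesis by blast
qed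

section \<open>Words\<close>

lemma card_words: "card (words m k) = m choose k"
proof (induction m arbitrary: k)
  case 0
  have "words 0 k = (if k = 0 then {[]} else {})" by (auto simp: words_def)
  then show ?case by (cases k) auto
next
  case (Suc m)
  have disj: "card ((#) False ` words m k \<union> (#) True ` words m l) = card (words m k) + card (words m l)"
    for k l
    by (subst card_Un_disjoint) (auto simp: finite_words card_image)
  show ?case
    by (cases k) (simp_all add: words_Suc disj Suc card_image)
qed

lemma mat_norm_word_prod_le_1:
  assumes "A \<in> carrier_mat n n" "B \<in> carrier_mat n n" "mat_norm A = 1" "mat_norm B = 1" "w \<noteq> []"
  shows "mat_norm (word_prod n A B w) \<le> 1"
  using assms(5)
proof (induction w)
  case (Cons b w)
  let ?X = "if b then B else A"
  have X: "?X \<in> carrier_mat n n" "mat_norm ?X = 1" using assms by auto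
  have W: "word_prod n A B w \<in> carrier_mat n n" using assms by (intro word_prod_carrier)
  show ?case
  proof (cases "w = []")
    case True
    then show ?thesis using X by simp
  next
    case False
    then show ?thesis using mat_norm_mult_le[OF X(1) W] X(2) Cons.IH by simp
  qed
qed simp

lemma cmod_trace_word_prod_le_1:
  assumes "A \<in> carrier_mat n n" "B \<in> carrier_mat n n" "mat_norm A = 1" "mat_norm B = 1"
    and "length w > 1"
  shows "cmod (mat_trace (word_prod n A B w)) \<le> 1"
proof -
  obtain b v where w: "w = b # v" "v \<noteq> []" using assms(5) by (cases w) auto
  let ?X = "if b then B else A"
  have X: "?X \<in> carrier_mat n n" "mat_norm ?X = 1" using assms by auto
  have "cmod (mat_trace (?X * word_prod n A B v)) \<le> mat_norm (word_prod n A B v)"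
    using cmod_trace_mult_le[OF X(1) word_prod_carrier[OF assms(1,2)]] X(2) by simp
  also have "\<dots> \<le> 1" using mat_norm_word_prod_le_1 assms(1-4) w(2) by blast
  finally show ?thesis using w by simp
qed

lemma mat_trace_word_sum:
  assumes "A \<in> carrier_mat n n" "B \<in> carrier_mat n n"
  shows "mat_trace (word_sum n m k A B) = (\<Sum>w\<in>words m k. mat_trace (word_prod n A B w))"
proof -
  have "mat_trace (word_prod n A B w) = (\<Sum>i<n. word_prod n A B w $$ (i, i))" for w
    using word_prod_carrier[OF assms, of w] by (simp add: mat_trace_def)
  then show ?thesis by (simp add: mat_trace_def word_sum_def) (rule sum.swap)
qed

lemma norm_sum_eq_cardD:
  fixes f :: "'a \<Rightarrow> complex"
  assumes "finite I" "\<And>i. i \<in> I \<Longrightarrow> cmod (f i) \<le> 1" "cmod (sum f I) = real (card I)" "i \<in> I"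
  shows "cmod (f i) = 1"
proof (rule ccontr)
  assume "cmod (f i) \<noteq> 1"
  then have "cmod (f i) < 1" using assms(2,4) by fastforce
  then have "(\<Sum>i\<in>I. cmod (f i)) < (\<Sum>i\<in>I. 1)"
    using assms by (intro sum_strict_mono_ex1) auto
  then show False using norm_sum[of f I] assms(3) by simp
qed

theorem theorem1p4:
  fixes n m k :: nat and A B :: "complex mat"
  assumes "n > 0" and "m > 1" and "k \<le> m"
    and "A \<in> carrier_mat n n" and "B \<in> carrier_mat n n"
    and "hermitian_mat A" and "hermitian_mat B"
    and "mat_norm A = 1" and "mat_norm B = 1"
  shows "cmod (mat_trace (word_sum n m k A B)) \<le> real (m choose k) \<and>
    (0 < k \<and> k < m \<and> cmod (mat_trace (word_sum n m k A B)) = real (m choose k) \<longrightarrow>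
       (A = B \<or> A = - B) \<and>
       (m > 2 \<longrightarrow> num_nonzero_eigenvalues A = 1))"
proof (intro conjI impI)
  note A = assms(4) assms(6) assms(8) and B = assms(5) assms(7) assms(9)
  note AB = assms(4,5)
  let ?T = "\<lambda>w. mat_trace (word_prod n A B w)"
  have le1: "cmod (?T w) \<le> 1" if "w \<in> words m k" for w
    using that assms(2) by (intro cmod_trace_word_prod_le_1) (auto simp: words_def assms)
  show "cmod (mat_trace (word_sum n m k A B)) \<le> real (m choose k)"
    unfolding mat_trace_word_sum[OF AB] card_words[symmetric]
    using sum_norm_le[of "words m k" ?T "\<lambda>_. 1"] le1 by simp
  assume "0 < k \<and> k < m \<and> cmod (mat_trace (word_sum n m k A B)) = real (m choose k)"
  then have k: "0 < k" "k < m"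
    and eq: "cmod (sum ?T (words m k)) = real (card (words m k))"
    by (auto simp: mat_trace_word_sum[OF AB] card_words)
  \<comment> \<open>A word that starts with \<open>AB\<close>; the order of the remaining letters is arbitrary.\<close>
  define u where "u = replicate (m - k - 1) False @ replicate (k - 1) True"
  have "count_list (replicate i b) True = (if b then i else 0)" for i b
    by (induction i) auto
  then have "False # True # u \<in> words m k"
    using k by (simp add: words_def u_def)
  from norm_sum_eq_cardD[OF finite_words le1 eq this]
  have tr: "cmod (mat_trace (A * (B * word_prod n A B u))) = 1" by simp
  have len: "length u = m - 2" using k by (auto simp: u_def)
  note U = word_prod_carrier[OF AB, of u]
  have long: "(A = B \<or> A = - B) \<and> num_nonzero_eigenvalues A = 1" if "m > 2"
  proof (rule norm_mult_eq_rank_one[OF A B])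
    have "u \<noteq> []" using that len by auto
    then have U1: "mat_norm (word_prod n A B u) \<le> 1"
      using mat_norm_word_prod_le_1 AB assms(8,9) by blast
    have "1 \<le> mat_norm (A * B) * mat_norm (word_prod n A B u)"
      using cmod_trace_mult_le[of "A * B" n n "word_prod n A B u"] tr AB U
      by (simp add: assoc_mult_mat[OF AB U])
    also have "\<dots> \<le> mat_norm (A * B)"
      using mult_left_mono[OF U1 mat_norm_nonneg] by simp
    finally show "mat_norm (A * B) = 1"
      using mat_norm_mult_le[OF AB] assms(8,9) by simp
  qed
  then show "num_nonzero_eigenvalues A = 1" if "m > 2" using that by blast
  show "A = B \<or> A = - B"
  proof (cases "m > 2")
    case False
    then have "u = []" using len assms(2) by simp
    then have "cmod (mat_trace (A * B)) = 1" using tr assms(5) by simp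
    then show ?thesis by (rule trace_mult_eq_scalar[OF A B])
  qed (use long in blast)
qed

end
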